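(* For all integers $m\geq 1$, $n\geq 1$ and $k\geq 1$, the modified complete bipartite graph $M^kK_{m,n}$ satisfies $$t(M^k K_{m,n})=k\, n^{m-1}(m+k-1)^{n-1}.$$
   Context: Graphs may have multiple edges; $t(G)$ denotes the number of spanning trees of $G$, with parallel edges distinguished. Let $K_{m,n}$ be the complete bipartite graph with vertex set $V_1\cup V_2$, where $V_1=\{p_1,\ldots,p_n\}$ and $V_2=\{q_1,\ldots,q_m\}$, each $q_j$ joined to each $p_i$ by one edge. The graph $M^kK_{m,n}$ is obtained from $K_{m,n}$ by replacing each edge between $q_m$ and $p_i$ ($i=1,\ldots,n$) by $k$ parallel edges; all other edges stay single. *)

theory Defs
  imports Main
begin

text \<open>
  Finite or infinite undirected multigraphs: parallel edges are distinct elements of the edge set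
  with the same set of endpoints, and a loop is an edge with a single endpoint.
\<close>

record ('v, 'e) multigraph =
  mverts :: "'v set"
  medges :: "'e set"
  mends :: "'e \<Rightarrow> 'v set"

definition wf_multigraph :: "('v, 'e) multigraph \<Rightarrow> bool" where
  "wf_multigraph G \<longleftrightarrow>
     (\<forall>e \<in> medges G. mends G e \<subseteq> mverts G \<and> card (mends G e) \<in> {1, 2})"

definition msubgraph :: "('v, 'e) multigraph \<Rightarrow> ('v, 'e) multigraph \<Rightarrow> bool" where
  "msubgraph H G \<longleftrightarrow> wf_multigraph G \<and> wf_multigraph H \<and>
     mverts H \<subseteq> mverts G \<and> medges H \<subseteq> medges G \<and> mends H = mends G"

definition mspanning :: "('v, 'e) multigraph \<Rightarrow> ('v, 'e) multigraph \<Rightarrow> bool" where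
  "mspanning H G \<longleftrightarrow> msubgraph H G \<and> mverts H = mverts G"

definition madjacent :: "('v, 'e) multigraph \<Rightarrow> 'v \<Rightarrow> 'v \<Rightarrow> bool" where
  "madjacent G u v \<longleftrightarrow> (\<exists>e \<in> medges G. mends G e = {u, v})"

definition mconnected :: "('v, 'e) multigraph \<Rightarrow> bool" where
  "mconnected G \<longleftrightarrow> mverts G \<noteq> {} \<and>
     (\<forall>u \<in> mverts G. \<forall>v \<in> mverts G. (madjacent G)\<^sup>*\<^sup>* u v)"

text \<open>
  Distinctness of the edges matters for cycles of length 2, which consist of two
  different parallel edges; a cycle of length 1 is a loop.
\<close>

definition mcycle :: "('v, 'e) multigraph \<Rightarrow> 'v list \<Rightarrow> 'e list \<Rightarrow> bool" where
  "mcycle G vs es \<longleftrightarrow> vs \<noteq> [] \<and> length es = length vs \<and> distinct vs \<and> distinct es \<and>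
     set vs \<subseteq> mverts G \<and> set es \<subseteq> medges G \<and>
     (\<forall>i < length vs. mends G (es ! i) = {vs ! i, vs ! (Suc i mod length vs)})"

definition mforest :: "('v, 'e) multigraph \<Rightarrow> bool" where
  "mforest G \<longleftrightarrow> \<not> (\<exists>vs es. mcycle G vs es)"

definition mtree :: "('v, 'e) multigraph \<Rightarrow> bool" where
  "mtree G \<longleftrightarrow> mconnected G \<and> mforest G"

definition mspanning_tree :: "('v, 'e) multigraph \<Rightarrow> ('v, 'e) multigraph \<Rightarrow> bool" where
  "mspanning_tree T G \<longleftrightarrow> mtree T \<and> mspanning T G"

definition num_spanning_trees :: "('v, 'e) multigraph \<Rightarrow> nat" where
  "num_spanning_trees G = card {T. mspanning_tree T G}"

definition multiply_edges ::
  "('v, 'e) multigraph \<Rightarrow> 'e set \<Rightarrow> nat \<Rightarrow> ('v, 'e \<times> nat) multigraph" where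
  "multiply_edges G F k =
     \<lparr> mverts = mverts G,
       medges = {(e, c). e \<in> medges G \<and> c \<in> {1..(if e \<in> F then k else 1)}},
       mends = (\<lambda>(e, c). mends G e) \<rparr>"

datatype bip_vertex = P nat | Q nat

text \<open>Following the source, \<open>m\<close> counts the vertices \<open>Q j\<close> and \<open>n\<close> the vertices \<open>P i\<close>.\<close>

definition complete_bipartite :: "nat \<Rightarrow> nat \<Rightarrow> (bip_vertex, nat \<times> nat) multigraph" where
  "complete_bipartite m n =
     \<lparr> mverts = P ` {1..n} \<union> Q ` {1..m},
       medges = {1..m} \<times> {1..n},
       mends = (\<lambda>(j, i). {Q j, P i}) \<rparr>"

definition modified_complete_bipartite ::
  "nat \<Rightarrow> nat \<Rightarrow> nat \<Rightarrow> (bip_vertex, (nat \<times> nat) \<times> nat) multigraph" where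
  "modified_complete_bipartite k m n =
     multiply_edges (complete_bipartite m n)
       {e \<in> medges (complete_bipartite m n). Q m \<in> mends (complete_bipartite m n) e} k"

lemma wf_modified_complete_bipartite: "wf_multigraph (modified_complete_bipartite k m n)"
  by (auto simp: wf_multigraph_def modified_complete_bipartite_def multiply_edges_def
      complete_bipartite_def)

lemma medges_modified_complete_bipartite:
  "medges (modified_complete_bipartite k m n) =
     {((j, i), c). j \<in> {1..m} \<and> i \<in> {1..n} \<and> c \<in> {1..(if j = m then k else 1)}}"
  by (auto simp: modified_complete_bipartite_def multiply_edges_def complete_bipartite_def)

end

theory Submission
  imports Defs "HOL-Library.FuncSet"
begin

text \<open>
  Orienting a spanning tree towards a root \<open>r\<close> assigns to each other vertex the edge to its parent;
  this identifies spanning trees with the edge assignments along which some rank decreases.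
  For \<open>r = Q m\<close> these become the acyclic maps \<open>h\<close> on \<open>A \<union> B\<close> with \<open>h ` A \<subseteq> B \<union> C\<close> and
  \<open>h ` B \<subseteq> A\<close>, where \<open>card A = n\<close>, \<open>card B = m - 1\<close> and \<open>C\<close> consists of \<open>k\<close> sinks.
  Let \<open>N(A, B, C)\<close> be their number. Cutting off the set \<open>S \<subseteq> A\<close> of the elements mapped into \<open>C\<close>
  makes \<open>S\<close> the new set of sinks and exchanges the two sides, so that \<open>N(A, B, C)\<close> is the sum of
  \<open>(card C) ^ (card S) * N(B, A - S, S)\<close> over all \<open>S\<close>. By induction and the derivative of the
  binomial theorem, \<open>N(A, B, C) = card C * (card A) ^ (card B) * (card B + card C) ^ (card A - 1)\<close>.
\<close>

section \<open>Spanning trees as parent maps towards a root\<close>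

text \<open>The rank is only required to exist, so that an assignment of parent edges is counted
  once and not once for each rank; extensionality likewise prevents copies that differ only off the
  domain. A loop cannot be \<open>p v\<close>, as it does not lower the rank.\<close>

definition parent_maps :: "('v, 'e) multigraph \<Rightarrow> 'v \<Rightarrow> ('v \<Rightarrow> 'e) set" where
  "parent_maps G r =
     {p \<in> (mverts G - {r}) \<rightarrow>\<^sub>E medges G. \<exists>rank :: 'v \<Rightarrow> nat. \<forall>v \<in> mverts G - {r}.
        \<exists>u \<in> mverts G. mends G (p v) = {v, u} \<and> rank u < rank v}"

text \<open>The path grows along the walk: a new vertex is appended, and a vertex that is already on
  the path causes the path to be cut back to it.\<close>

lemma madjacent_rtranclp_imp_simple_path:
  assumes "(madjacent H)\<^sup>*\<^sup>* u v" "u \<in> mverts H" "wf_multigraph H"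
  shows "\<exists>vs es. vs \<noteq> [] \<and> distinct vs \<and> hd vs = u \<and> last vs = v \<and> length vs = Suc (length es) \<and>
    set vs \<subseteq> mverts H \<and> set es \<subseteq> medges H \<and>
    (\<forall>i < length es. mends H (es ! i) = {vs ! i, vs ! Suc i})"
  using assms(1)
proof (induction rule: rtranclp_induct)
  case base
  show ?case
    using assms(2) by (intro exI[of _ "[u]"] exI[of _ "[]"]) auto
next
  case (step v w)
  obtain vs es where path: "vs \<noteq> []" "distinct vs" "hd vs = u" "last vs = v"
    "length vs = Suc (length es)" "set vs \<subseteq> mverts H" "set es \<subseteq> medges H"
    "\<And>i. i < length es \<Longrightarrow> mends H (es ! i) = {vs ! i, vs ! Suc i}"
    using step.IH by blast
  obtain e where e: "e \<in> medges H" "mends H e = {v, w}"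
    using step.hyps(2) by (auto simp: madjacent_def)
  have w: "w \<in> mverts H"
    using e assms(3) by (auto simp: wf_multigraph_def)
  show ?case
  proof (cases "w \<in> set vs")
    case True
    then obtain i where i: "i < length vs" "vs ! i = w"
      by (auto simp: in_set_conv_nth)
    have "last (take (Suc i) vs) = w"
      using i by (simp add: take_Suc_conv_app_nth)
    moreover have "set (take (Suc i) vs) \<subseteq> mverts H" "set (take i es) \<subseteq> medges H"
      using path set_take_subset by fastforce+
    ultimately show ?thesis
      using path i by (intro exI[of _ "take (Suc i) vs"] exI[of _ "take i es"]) (auto simp: hd_take)
  next
    case False
    have "mends H ((es @ [e]) ! i) = {(vs @ [w]) ! i, (vs @ [w]) ! Suc i}"
      if "i < length (es @ [e])" for i
    proof (cases "i < length es")
      case True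
      then show ?thesis using path by (simp add: nth_append)
    next
      case False
      then have "i = length es" using that by simp
      moreover have "vs ! length es = v"
        using path by (simp add: last_conv_nth)
      ultimately show ?thesis using path e by (simp add: nth_append)
    qed
    then show ?thesis
      using path e w False by (intro exI[of _ "vs @ [w]"] exI[of _ "es @ [e]"]) auto
  qed
qed

text \<open>A simple path in \<open>H\<close> from \<open>a\<close> to \<open>b\<close> is closed by
  \<open>e\<close>. As \<open>e\<close> is not in \<open>H\<close>, the edges stay distinct even if
  \<open>e\<close> is parallel to an edge of the path. For a loop \<open>e\<close> the path is the
  single vertex \<open>a\<close>.\<close>

lemma mcycle_if_extra_edge:
  assumes "wf_multigraph H" "(madjacent H)\<^sup>*\<^sup>* a b" "a \<in> mverts H"
    and "mverts H \<subseteq> mverts G" "medges H \<subseteq> medges G" "mends H = mends G"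
    and "e \<in> medges G" "e \<notin> medges H" "mends G e = {a, b}"
  shows "\<exists>vs es. mcycle G vs es"
proof -
  obtain vs es where path: "vs \<noteq> []" "distinct vs" "hd vs = a" "last vs = b"
    "length vs = Suc (length es)" "set vs \<subseteq> mverts H" "set es \<subseteq> medges H"
    "\<And>i. i < length es \<Longrightarrow> mends H (es ! i) = {vs ! i, vs ! Suc i}"
    using madjacent_rtranclp_imp_simple_path[OF assms(2,3,1)] by blast
  have "distinct es"
    unfolding distinct_conv_nth
  proof (intro allI impI notI)
    fix i j assume ij: "i < length es" "j < length es" "i \<noteq> j" "es ! i = es ! j"
    then have "{vs ! i, vs ! Suc i} = {vs ! j, vs ! Suc j}"
      using path(8) by metis
    \<comment> \<open>The crosswise case would give \<open>i = Suc j\<close> and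
      \<open>Suc i = j\<close>, since the vertices are distinct.\<close>
    then have "(vs ! i = vs ! j \<and> vs ! Suc i = vs ! Suc j) \<or>
      (vs ! i = vs ! Suc j \<and> vs ! Suc i = vs ! j)"
      by (auto simp: doubleton_eq_iff)
    then show False
      using ij path(2,5) by (auto simp: nth_eq_iff_index_eq)
  qed
  moreover have "mends G ((es @ [e]) ! i) = {vs ! i, vs ! (Suc i mod length vs)}"
    if "i < length vs" for i
  proof (cases "i < length es")
    case True
    then show ?thesis using path assms(6) by (simp add: nth_append)
  next
    case False
    then have "i = length es" using that path by simp
    moreover have "vs ! length es = b" "vs ! 0 = a"
      using path by (auto simp: last_conv_nth hd_conv_nth)
    ultimately show ?thesis using path assms(9) by auto
  qed
  ultimately have "mcycle G vs (es @ [e])"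
    unfolding mcycle_def using path assms(4-8) by auto
  then show ?thesis by blast
qed

text \<open>At a vertex of maximal rank on a cycle, both cycle edges would have to be its one parent
  edge, although the edges of a cycle are distinct.\<close>

lemma mforest_if_parent_ranks:
  fixes rank :: "'v \<Rightarrow> nat"
  assumes edges: "\<And>e. e \<in> medges T \<Longrightarrow> \<exists>v u. e = p v \<and> mends T e = {v, u} \<and> rank u < rank v"
  shows "mforest T"
  unfolding mforest_def
proof (intro notI, elim exE)
  fix vs es assume cyc: "mcycle T vs es"
  define l where "l = length vs"
  have l: "l > 0" "length es = l" "distinct es" "set es \<subseteq> medges T"
    "\<And>i. i < l \<Longrightarrow> mends T (es ! i) = {vs ! i, vs ! (Suc i mod l)}"
    using cyc by (auto simp: mcycle_def l_def)
  define M where "M = Max (rank ` set vs)"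
  have "M \<in> rank ` set vs"
    unfolding M_def using l by (intro Max_in) (auto simp: l_def)
  then obtain i where i: "i < l" "rank (vs ! i) = M"
    by (auto simp: l_def in_set_conv_nth)
  have max: "rank (vs ! j) \<le> rank (vs ! i)" if "j < l" for j
    unfolding i(2) M_def using that by (auto simp: l_def)
  \<comment> \<open>By maximality the lower endpoint of a cycle edge ranks strictly below
    \<open>vs ! i\<close>. Hence an edge at \<open>vs ! i\<close> has \<open>vs ! i\<close> as its
    higher endpoint and is the parent edge of it.\<close>
  have top: "es ! j = p (vs ! i) \<and> (\<exists>u. mends T (es ! j) = {vs ! i, u} \<and> u \<noteq> vs ! i)"
    if "j < l" "vs ! i \<in> mends T (es ! j)" for j
  proof -
    have "es ! j \<in> medges T"
      using l(2,4) that(1) nth_mem[of j es] by auto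
    then obtain v u where vu: "es ! j = p v" "mends T (es ! j) = {v, u}" "rank u < rank v"
      using edges by blast
    have "v \<in> {vs ! j, vs ! (Suc j mod l)}"
      using vu l(5)[OF that(1)] by auto
    then have "rank v \<le> rank (vs ! i)"
      using max[of j] max[of "Suc j mod l"] that l(1) by auto
    then have "v = vs ! i" using vu that by auto
    then show ?thesis using vu by auto
  qed
  show False
  proof (cases "l = 1")
    case True
    then show False
      using top[of i] i l(5)[of i] by (auto simp: doubleton_eq_iff)
  next
    case False
    \<comment> \<open>The cyclic predecessor of \<open>i\<close>: the edges \<open>es ! j\<close>
      and \<open>es ! i\<close> are the two that meet \<open>vs ! i\<close>.\<close>
    define j where "j = (if i = 0 then l - 1 else i - 1)"
    have j: "j < l" "j \<noteq> i" "Suc j mod l = i"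
      using i l(1) False by (auto simp: j_def)
    have "es ! i = p (vs ! i)" "es ! j = p (vs ! i)"
      using top[of i] top[of j] i j l(5)[of i] l(5)[of j] by auto
    then show False
      using l i j by (metis nth_eq_iff_index_eq)
  qed
qed

text \<open>Passing from parent to parent lowers the rank, so it must stop, and it can stop only at
  \<open>r\<close>.\<close>

lemma mconnected_if_parent_ranks:
  fixes rank :: "'v \<Rightarrow> nat"
  assumes "r \<in> mverts T"
    and parent: "\<And>v. v \<in> mverts T - {r} \<Longrightarrow>
      \<exists>u \<in> mverts T. \<exists>e \<in> medges T. mends T e = {v, u} \<and> rank u < rank v"
  shows "mconnected T"
proof -
  have sym: "symp (madjacent T)"
    by (auto simp: symp_def madjacent_def insert_commute)
  have to_r: "(madjacent T)\<^sup>*\<^sup>* v r" if "v \<in> mverts T" for v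
    using that
  proof (induction "rank v" arbitrary: v rule: less_induct)
    case less
    show ?case
    proof (cases "v = r")
      case False
      then obtain u where u: "u \<in> mverts T" "madjacent T v u" "rank u < rank v"
        using parent[of v] less.prems by (auto simp: madjacent_def)
      then show ?thesis
        using less.hyps[of u] by (metis converse_rtranclp_into_rtranclp)
    qed simp
  qed
  have "(madjacent T)\<^sup>*\<^sup>* r v" if "v \<in> mverts T" for v
    using to_r[OF that] symp_rtranclp[OF sym] by (metis sympD)
  then show ?thesis
    using to_r assms(1) unfolding mconnected_def by (metis emptyE rtranclp_trans)
qed

text \<open>The rank is the distance from \<open>r\<close>, and the parent edge of a vertex is the
  last edge of a shortest walk from \<open>r\<close> to it.\<close>

lemma mconnected_imp_parent_ranks:
  assumes "mconnected T" "r \<in> mverts T" "wf_multigraph T"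
  obtains p and rank :: "'v \<Rightarrow> nat" where
    "\<And>v. v \<in> mverts (T :: ('v, 'e) multigraph) - {r} \<Longrightarrow>
       p v \<in> medges T \<and> (\<exists>u \<in> mverts T. mends T (p v) = {v, u} \<and> rank u < rank v)"
proof -
  define d where "d v = (LEAST n. (madjacent T ^^ n) r v)" for v
  have "\<exists>e \<in> medges T. \<exists>u \<in> mverts T. mends T e = {v, u} \<and> d u < d v"
    if v: "v \<in> mverts T - {r}" for v
  proof -
    have "(madjacent T)\<^sup>*\<^sup>* r v"
      using assms v by (auto simp: mconnected_def)
    then have "\<exists>n. (madjacent T ^^ n) r v"
      by (simp add: rtranclp_power)
    then have dv: "(madjacent T ^^ d v) r v"
      unfolding d_def by (rule LeastI_ex)
    show ?thesis
    proof (cases "d v")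
      case 0
      then show ?thesis using dv v by simp
    next
      case (Suc n)
      then obtain u where u: "(madjacent T ^^ n) r u" "madjacent T u v"
        using dv by auto
      have "d u \<le> n"
        unfolding d_def using u(1) by (rule Least_le)
      moreover obtain e where "e \<in> medges T" "mends T e = {u, v}"
        using u(2) by (auto simp: madjacent_def)
      moreover from this have "u \<in> mverts T"
        using assms(3) by (auto simp: wf_multigraph_def)
      ultimately show ?thesis
        using Suc by (intro bexI[of _ e] bexI[of _ u]) auto
    qed
  qed
  then obtain p where "\<forall>v \<in> mverts T - {r}.
      p v \<in> medges T \<and> (\<exists>u \<in> mverts T. mends T (p v) = {v, u} \<and> d u < d v)"
    by metis
  then show thesis
    using that[of p d] by blast
qed

lemma inj_on_if_parent_ranks:
  fixes rank :: "'v \<Rightarrow> nat"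
  assumes "\<And>v. v \<in> A \<Longrightarrow> \<exists>u. ends (p v) = {v, u} \<and> rank u < rank v"
  shows "inj_on p A"
proof (rule inj_onI)
  fix v w assume vw: "v \<in> A" "w \<in> A" "p v = p w"
  obtain u u' where "ends (p v) = {v, u}" "rank u < rank v" "ends (p w) = {w, u'}" "rank u' < rank w"
    using assms vw by metis
  then show "v = w"
    using vw(3) by (auto simp: doubleton_eq_iff)
qed

text \<open>The edge set alone determines the orientation towards \<open>r\<close>: a vertex of
  highest \<open>rank\<close> at which two parent maps differ would have a child, again with
  different values, of still higher rank.\<close>

lemma parent_map_unique:
  assumes fin: "finite (mverts G)"
    and p: "p \<in> parent_maps G r" and q: "q \<in> parent_maps G r"
    and img: "p ` (mverts G - {r}) = q ` (mverts G - {r})"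
  shows "p = q"
proof (rule ccontr)
  assume "p \<noteq> q"
  let ?W = "mverts G - {r}"
  define D where "D = {v \<in> ?W. p v \<noteq> q v}"
  obtain rank :: "_ \<Rightarrow> nat" where rank:
    "\<And>v. v \<in> ?W \<Longrightarrow> \<exists>u \<in> mverts G. mends G (p v) = {v, u} \<and> rank u < rank v"
    using p by (auto simp: parent_maps_def)
  obtain rank' :: "_ \<Rightarrow> nat" where rank':
    "\<And>v. v \<in> ?W \<Longrightarrow> \<exists>u \<in> mverts G. mends G (q v) = {v, u} \<and> rank' u < rank' v"
    using q by (auto simp: parent_maps_def)
  have inj: "inj_on q ?W"
    using rank' by (intro inj_on_if_parent_ranks[where ends = "mends G" and rank = rank']) blast
  have "p \<in> extensional ?W" "q \<in> extensional ?W"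
    using p q by (auto simp: parent_maps_def PiE_def)
  then have "D \<noteq> {}"
    using \<open>p \<noteq> q\<close> by (auto simp: D_def intro: extensionalityI)
  moreover have "finite D"
    using fin by (simp add: D_def)
  ultimately obtain v where v: "v \<in> D" "\<And>w. w \<in> D \<Longrightarrow> rank w \<le> rank v"
    using Max_in[of "rank ` D"] Max_ge[of "rank ` D"] by (metis (no_types, lifting) finite_imageI
      image_iff image_is_empty)
  \<comment> \<open>The edge \<open>q v\<close> is \<open>p w\<close> for a \<open>p\<close>-child \<open>w\<close> of \<open>v\<close>, at which the two maps differ as well.\<close>
  have vW: "v \<in> ?W" "p v \<noteq> q v"
    using v(1) by (auto simp: D_def)
  obtain w where w: "w \<in> ?W" "q v = p w"
    using vW(1) img by (metis imageE imageI)
  have "w \<noteq> v" using w vW by auto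
  obtain u where u: "mends G (p w) = {w, u}" "rank u < rank w"
    using rank[OF w(1)] by blast
  have "v \<in> mends G (q v)"
    using rank'[OF vW(1)] by auto
  then have "u = v"
    using u w(2) \<open>w \<noteq> v\<close> by auto
  \<comment> \<open>Otherwise \<open>q w = p w = q v\<close>, against the injectivity of
    \<open>q\<close>.\<close>
  moreover have "w \<in> D"
    using w inj \<open>w \<noteq> v\<close> vW(1) by (auto simp: D_def inj_on_def)
  ultimately show False
    using v(2)[of w] u(2) by simp
qed

lemma num_spanning_trees_eq_card_parent_maps:
  fixes G :: "('v, 'e) multigraph"
  assumes fin: "finite (mverts G)" and wf: "wf_multigraph G" and r: "r \<in> mverts G"
  shows "num_spanning_trees G = card (parent_maps G r)"
proof -
  let ?W = "mverts G - {r}"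
  \<comment> \<open>A spanning subgraph keeps the vertices and the end function of \<open>G\<close>;
    only its edge set is free.\<close>
  define tree where "tree p = \<lparr>mverts = mverts G, medges = p ` ?W, mends = mends G\<rparr>"
    for p :: "'v \<Rightarrow> 'e"
  have wf_tree: "wf_multigraph (tree p)" if "p ` ?W \<subseteq> medges G" for p
    using wf that by (auto simp: wf_multigraph_def tree_def)
  have "bij_betw tree (parent_maps G r) {T. mspanning_tree T G}"
    unfolding bij_betw_def
  proof (intro conjI subset_antisym subsetI)
    show "inj_on tree (parent_maps G r)"
      by (rule inj_onI, rule parent_map_unique[OF fin]) (auto simp: tree_def)
  next
    fix T assume "T \<in> tree ` parent_maps G r"
    then obtain p where p: "p \<in> parent_maps G r" and T: "T = tree p"
      by auto
    obtain rank :: "_ \<Rightarrow> nat" where rank: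
      "\<And>v. v \<in> ?W \<Longrightarrow> \<exists>u \<in> mverts G. mends G (p v) = {v, u} \<and> rank u < rank v"
      using p by (auto simp: parent_maps_def)
    have sub: "p ` ?W \<subseteq> medges G"
      using p by (auto simp: parent_maps_def)
    have "mforest T"
      by (rule mforest_if_parent_ranks[of T p rank]) (use rank in \<open>fastforce simp: T tree_def\<close>)
    moreover have "mconnected T"
      by (rule mconnected_if_parent_ranks[of r T rank]) (use rank r in \<open>fastforce simp: T tree_def\<close>)+
    moreover have "mspanning T G"
      using wf wf_tree[OF sub] sub
      by (simp add: mspanning_def msubgraph_def T) (simp add: tree_def)
    ultimately show "T \<in> {T. mspanning_tree T G}"
      by (simp add: mspanning_tree_def mtree_def)
  next
    fix T assume "T \<in> {T. mspanning_tree T G}"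
    then have T: "mconnected T" "mforest T" "wf_multigraph T" "mverts T = mverts G"
      "medges T \<subseteq> medges G" "mends T = mends G"
      by (auto simp: mspanning_tree_def mtree_def mspanning_def msubgraph_def)
    obtain p' and rank :: "'v \<Rightarrow> nat" where p':
      "\<And>v. v \<in> ?W \<Longrightarrow> p' v \<in> medges T \<and> (\<exists>u \<in> mverts G. mends G (p' v) = {v, u} \<and> rank u < rank v)"
      using mconnected_imp_parent_ranks[OF T(1) _ T(3), of r] r T(4,6) by metis
    define p where "p = restrict p' ?W"
    have p: "p v \<in> medges T \<and> (\<exists>u \<in> mverts G. mends G (p v) = {v, u} \<and> rank u < rank v)"
      if "v \<in> ?W" for v
      using p'[OF that] that by (simp add: p_def)
    have sub: "p ` ?W \<subseteq> medges T"
      using p by auto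
    have pm: "p \<in> parent_maps G r"
      using p T(5) by (fastforce simp: parent_maps_def p_def)
    have conn: "mconnected (tree p)"
      by (rule mconnected_if_parent_ranks[of r "tree p" rank]) (use p r in \<open>fastforce simp: tree_def\<close>)+
    have wfp: "wf_multigraph (tree p)"
      using wf_tree sub T(5) by blast
    \<comment> \<open>The chosen parent edges already connect all vertices, so any further edge of
      \<open>T\<close> would close a cycle in \<open>T\<close>.\<close>
    have "medges T \<subseteq> p ` ?W"
    proof (rule ccontr)
      assume "\<not> medges T \<subseteq> p ` ?W"
      then obtain e where e: "e \<in> medges T" "e \<notin> p ` ?W" by blast
      have card_e: "mends T e \<subseteq> mverts T" "card (mends T e) \<in> {1, 2}"
        using T(3) e(1) by (auto simp: wf_multigraph_def)
      obtain a b where ab: "mends T e = {a, b}"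
        using card_e(2) by (auto simp: card_2_iff card_1_singleton_iff)
      have "a \<in> mverts G" "b \<in> mverts G"
        using ab card_e T(4) by auto
      then have "(madjacent (tree p))\<^sup>*\<^sup>* a b"
        using conn by (simp add: mconnected_def tree_def)
      then have "\<exists>vs es. mcycle T vs es"
        by (rule mcycle_if_extra_edge[OF wfp])
          (use \<open>a \<in> mverts G\<close> sub T e ab in \<open>simp_all add: tree_def\<close>)
      then show False
        using T(2) by (simp add: mforest_def)
    qed
    then have "T = tree p"
      using sub T by (simp add: tree_def)
    then show "T \<in> tree ` parent_maps G r"
      using pm by blast
  qed
  then show ?thesis
    by (simp add: num_spanning_trees_def bij_betw_same_card)
qed

section \<open>Acyclic maps between two sides with sinks\<close>

text \<open>Both sides and the sinks share one type, so that the recursion can exchange their roles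
  and turn elements of \<open>A\<close> into sinks. The rank forces every orbit to leave
  \<open>A \<union> B\<close>, which is possible only into \<open>C\<close>.\<close>

definition acyclic_maps :: "'a set \<Rightarrow> 'a set \<Rightarrow> 'a set \<Rightarrow> ('a \<Rightarrow> 'a) set" where
  "acyclic_maps A B C =
     {h \<in> \<Pi>\<^sub>E x \<in> A \<union> B. (if x \<in> A then B \<union> C else A).
        \<exists>rank :: 'a \<Rightarrow> nat. \<forall>x \<in> A \<union> B. rank (h x) < rank x}"

lemma finite_acyclic_maps:
  assumes "finite A" "finite B" "finite C"
  shows "finite (acyclic_maps A B C)"
proof -
  have "finite (\<Pi>\<^sub>E x \<in> A \<union> B. (if x \<in> A then B \<union> C else A))"
    using assms by (intro finite_PiE) auto
  then show ?thesis
    by (rule rev_finite_subset) (auto simp: acyclic_maps_def)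
qed

text \<open>Without sinks a map would send \<open>A \<union> B\<close> to itself, and its rank would
  descend forever.\<close>

lemma acyclic_maps_no_sinks:
  assumes "A \<noteq> {}"
  shows "acyclic_maps A B {} = {}"
proof (rule ccontr)
  assume "acyclic_maps A B {} \<noteq> {}"
  then obtain h and rank :: "'a \<Rightarrow> nat" where
    h: "h \<in> (\<Pi>\<^sub>E x \<in> A \<union> B. (if x \<in> A then B \<union> {} else A))"
    and rank: "\<And>x. x \<in> A \<union> B \<Longrightarrow> rank (h x) < rank x"
    unfolding acyclic_maps_def by blast
  have "h x \<in> A \<union> B" if "x \<in> A \<union> B" for x
    using PiE_mem[OF h that] by (simp split: if_splits)
  then have "x \<notin> A \<union> B" for x
    by (induction "rank x" arbitrary: x rule: less_induct) (use rank in blast)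
  then show False
    using assms by blast
qed

text \<open>The maps with a given \<open>S\<close> form a product. On \<open>S\<close> the values in
  \<open>C\<close> are arbitrary; on the rest, elements of \<open>B\<close> go to
  \<open>(A - S) \<union> S\<close> and those of \<open>A - S\<close> only to \<open>B\<close>,
  which is the same kind of map with \<open>B\<close> as first side and \<open>S\<close> as
  sinks.\<close>

lemma card_acyclic_maps_rec:
  fixes A B C :: "'a set"
  assumes fin: "finite A" "finite B" "finite C"
    and disj: "A \<inter> B = {}" "A \<inter> C = {}" "B \<inter> C = {}"
  shows "card (acyclic_maps A B C) =
    (\<Sum>S \<in> Pow A. card C ^ card S * card (acyclic_maps B (A - S) S))"
proof -
  define fibre where "fibre S = {h \<in> acyclic_maps A B C. {a \<in> A. h a \<in> C} = S}" for S
  have "acyclic_maps A B C = (\<Union>S \<in> Pow A. fibre S)"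
    unfolding fibre_def by blast
  moreover have "card (\<Union>S \<in> Pow A. fibre S) = (\<Sum>S \<in> Pow A. card (fibre S))"
  proof (rule card_UN_disjoint)
    show "\<forall>S \<in> Pow A. finite (fibre S)"
      using finite_acyclic_maps[OF fin] by (simp add: fibre_def)
    show "\<forall>S \<in> Pow A. \<forall>S' \<in> Pow A. S \<noteq> S' \<longrightarrow> fibre S \<inter> fibre S' = {}"
      unfolding fibre_def by blast
  qed (use fin in simp)
  moreover have "card (fibre S) = card C ^ card S * card (acyclic_maps B (A - S) S)"
    if S: "S \<subseteq> A" for S
  proof -
    define W where "W = B \<union> (A - S)"
    have W: "A \<union> B = S \<union> W" "S \<inter> W = {}"
      using S disj by (auto simp: W_def)
    define split where "split h = (restrict h S, restrict h W)" for h :: "'a \<Rightarrow> 'a"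
    \<comment> \<open>Off \<open>S\<close> the second component is used, also outside
      \<open>A \<union> B\<close>, where its value \<open>undefined\<close> makes the glued map
      extensional.\<close>
    define glue where "glue = (\<lambda>(f :: 'a \<Rightarrow> 'a, g) x. if x \<in> S then f x else g x)"
    have "bij_betw split (fibre S) ((S \<rightarrow>\<^sub>E C) \<times> acyclic_maps B (A - S) S)"
    proof (rule bij_betwI[where g = glue])
      show "split \<in> fibre S \<rightarrow> (S \<rightarrow>\<^sub>E C) \<times> acyclic_maps B (A - S) S"
      proof (rule funcsetI)
        fix h assume "h \<in> fibre S"
        then have h: "h \<in> (\<Pi>\<^sub>E x \<in> A \<union> B. (if x \<in> A then B \<union> C else A))"
          "{a \<in> A. h a \<in> C} = S" and ex: "\<exists>rank :: 'a \<Rightarrow> nat. \<forall>x \<in> A \<union> B. rank (h x) < rank x"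
          by (auto simp: fibre_def acyclic_maps_def)
        have hA: "h x \<in> B \<union> C" if "x \<in> A" for x
          using PiE_mem[OF h(1), of x] that by auto
        have hB: "h x \<in> A" if "x \<in> B" for x
          using PiE_mem[OF h(1), of x] that disj(1) by (auto split: if_splits)
        have hC: "h x \<in> C \<longleftrightarrow> x \<in> S" if "x \<in> A" for x
          using h(2) that by blast
        have "restrict h S \<in> S \<rightarrow>\<^sub>E C"
          using hC S by auto
        moreover have "restrict h W \<in> (\<Pi>\<^sub>E x \<in> W. (if x \<in> B then (A - S) \<union> S else B))"
        proof (rule restrict_PiE_iff[THEN iffD2], rule ballI)
          fix x assume "x \<in> W"
          then consider "x \<in> B" | "x \<in> A - S" "x \<notin> B"
            using disj by (auto simp: W_def)
          then show "h x \<in> (if x \<in> B then (A - S) \<union> S else B)"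
            using hA[of x] hB[of x] hC[of x] by cases auto
        qed
        moreover have "\<exists>rank :: 'a \<Rightarrow> nat. \<forall>x \<in> W. rank (restrict h W x) < rank x"
        proof -
          obtain rank :: "'a \<Rightarrow> nat" where "\<forall>x \<in> A \<union> B. rank (h x) < rank x"
            using ex by blast
          then have "\<forall>x \<in> W. rank (restrict h W x) < rank x"
            using W(1) by simp
          then show ?thesis by blast
        qed
        ultimately show "split h \<in> (S \<rightarrow>\<^sub>E C) \<times> acyclic_maps B (A - S) S"
          by (simp add: split_def acyclic_maps_def flip: W_def)
      qed
    next
      show "glue \<in> (S \<rightarrow>\<^sub>E C) \<times> acyclic_maps B (A - S) S \<rightarrow> fibre S"
      proof (rule funcsetI)
        fix y assume "y \<in> (S \<rightarrow>\<^sub>E C) \<times> acyclic_maps B (A - S) S"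
        then obtain f g where y: "y = (f, g)" and f: "f \<in> S \<rightarrow>\<^sub>E C"
          and "g \<in> acyclic_maps B (A - S) S"
          by (rule SigmaE)
        then have g: "g \<in> (\<Pi>\<^sub>E x \<in> W. (if x \<in> B then (A - S) \<union> S else B))"
          and "\<exists>rank :: 'a \<Rightarrow> nat. \<forall>x \<in> W. rank (g x) < rank x"
          by (auto simp: acyclic_maps_def W_def)
        then obtain rank :: "'a \<Rightarrow> nat" where rank: "\<And>x. x \<in> W \<Longrightarrow> rank (g x) < rank x"
          by blast
        have fS: "f x \<in> C" if "x \<in> S" for x
          using f that by auto
        have gB: "g x \<in> A" if "x \<in> B" for x
          using PiE_mem[OF g, of x] that S by (auto simp: W_def)
        have gA: "g x \<in> B" if "x \<in> A - S" for x
          using PiE_mem[OF g, of x] that disj by (auto simp: W_def split: if_splits)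
        have gU: "g x = undefined" if "x \<notin> W" for x
          using PiE_arb[OF g] that by auto
        let ?h = "glue y"
        have "?h \<in> (\<Pi>\<^sub>E x \<in> A \<union> B. (if x \<in> A then B \<union> C else A))"
        proof (rule PiE_I)
          fix x assume "x \<in> A \<union> B"
          then consider "x \<in> S" "x \<in> A" | "x \<in> A - S" | "x \<in> B" "x \<notin> A" "x \<notin> S"
            using S disj by auto
          then show "?h x \<in> (if x \<in> A then B \<union> C else A)"
            by cases (use fS[of x] gA[of x] gB[of x] in \<open>auto simp: glue_def y\<close>)
        next
          fix x assume "x \<notin> A \<union> B"
          then show "?h x = undefined"
            using gU[of x] W(1) by (simp add: glue_def y)
        qed
        moreover have "?h a \<in> C \<longleftrightarrow> a \<in> S" if "a \<in> A" for a
          using fS[of a] gA[of a] that disj(3) by (auto simp: glue_def y)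
        then have "{a \<in> A. ?h a \<in> C} = S"
          using S by blast
        moreover have "\<exists>rank' :: 'a \<Rightarrow> nat. \<forall>x \<in> A \<union> B. rank' (?h x) < rank' x"
        proof (intro exI ballI)
          fix x assume x: "x \<in> A \<union> B"
          \<comment> \<open>The condition on \<open>rank\<close> concerns \<open>W\<close> only.
            Rank 0 for \<open>C\<close> and a shift by one elsewhere put the elements of
            \<open>S\<close> above their images too.\<close>
          let ?rank = "\<lambda>y. if y \<in> C then 0 else Suc (rank y)"
          have "x \<notin> C" using x disj by auto
          moreover have "rank (g x) < rank x" if "x \<notin> S"
            using rank x W that by auto
          ultimately show "?rank (?h x) < ?rank x"
            using fS by (auto simp: glue_def y)
        qed
        ultimately show "?h \<in> fibre S"
          by (simp add: fibre_def acyclic_maps_def)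
      qed
    next
      fix h assume "h \<in> fibre S"
      then have "h \<in> extensional (A \<union> B)"
        by (auto simp: fibre_def acyclic_maps_def PiE_def)
      then show "glue (split h) = h"
        using W by (auto simp: glue_def split_def fun_eq_iff extensional_def)
    next
      fix y assume "y \<in> (S \<rightarrow>\<^sub>E C) \<times> acyclic_maps B (A - S) S"
      then have "fst y \<in> extensional S" "snd y \<in> extensional W"
        by (auto simp: acyclic_maps_def PiE_def W_def)
      then show "split (glue y) = y"
        using W(2) by (cases y) (auto simp: glue_def split_def fun_eq_iff extensional_def restrict_def)
    qed
    then have "card (fibre S) = card ((S \<rightarrow>\<^sub>E C) \<times> acyclic_maps B (A - S) S)"
      by (rule bij_betw_same_card)
    also have "\<dots> = card C ^ card S * card (acyclic_maps B (A - S) S)"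
      using finite_subset[OF S fin(1)] by (simp add: card_cartesian_product card_PiE)
    finally show ?thesis .
  qed
  ultimately show ?thesis by simp
qed

section \<open>Binomial sums over subsets\<close>

lemma sum_Pow_insert:
  fixes f :: "'a set \<Rightarrow> 'b :: comm_monoid_add"
  assumes "finite A" "a \<notin> A"
  shows "(\<Sum>S \<in> Pow (insert a A). f S) = (\<Sum>S \<in> Pow A. f S) + (\<Sum>S \<in> Pow A. f (insert a S))"
proof -
  have "inj_on (insert a) (Pow A)"
    using assms(2) by (intro inj_onI) (metis PowD insert_ident subsetD)
  moreover have "Pow A \<inter> insert a ` Pow A = {}"
    using assms(2) by blast
  ultimately show ?thesis
    using assms(1) by (simp add: Pow_insert sum.union_disjoint sum.reindex)
qed

lemma card_insert_Diff_subset: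
  assumes "finite A" "a \<notin> A" "S \<subseteq> A"
  shows "card (insert a A - S) = Suc (card (A - S))" "card (insert a S) = Suc (card S)"
    "A - insert a S = A - S"
proof -
  have "insert a A - S = insert a (A - S)"
    using assms by auto
  then show "card (insert a A - S) = Suc (card (A - S))"
    using assms by simp
  show "card (insert a S) = Suc (card S)"
    using assms finite_subset[of S A] by (intro card_insert_disjoint) auto
  show "A - insert a S = A - S"
    using assms by auto
qed

text \<open>In the expanded power each element of \<open>A\<close> contributes \<open>x\<close> if
  it lies in \<open>S\<close> and \<open>y\<close> otherwise.\<close>

lemma sum_Pow_binomial:
  fixes x y :: "'b :: comm_semiring_1"
  assumes "finite A"
  shows "(\<Sum>S \<in> Pow A. x ^ card S * y ^ card (A - S)) = (x + y) ^ card A"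
  using assms
proof (induction A rule: finite_induct)
  case (insert a A)
  have "(\<Sum>S \<in> Pow (insert a A). x ^ card S * y ^ card (insert a A - S)) =
    (\<Sum>S \<in> Pow A. y * (x ^ card S * y ^ card (A - S))) +
    (\<Sum>S \<in> Pow A. x * (x ^ card S * y ^ card (A - S)))"
    unfolding sum_Pow_insert[OF insert.hyps]
    by (intro arg_cong2[where f = "(+)"] sum.cong)
      (simp_all add: card_insert_Diff_subset[OF insert.hyps] ac_simps)
  then show ?case
    using insert by (simp add: algebra_simps flip: sum_distrib_left)
qed simp

text \<open>This is \<open>x\<close> times the derivative in \<open>x\<close> of the binomial
  theorem, obtained here by induction on \<open>A\<close> without differentiating.\<close>

lemma sum_Pow_card_binomial:
  fixes x y :: nat
  assumes "finite A"
  shows "(\<Sum>S \<in> Pow A. card S * (x ^ card S * y ^ card (A - S))) =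
    card A * x * (x + y) ^ (card A - 1)"
  using assms
proof (induction A rule: finite_induct)
  case (insert a A)
  let ?g = "\<lambda>S. x ^ card S * y ^ card (A - S)"
  have "(\<Sum>S \<in> Pow (insert a A). card S * (x ^ card S * y ^ card (insert a A - S))) =
    (\<Sum>S \<in> Pow A. y * (card S * ?g S)) + (\<Sum>S \<in> Pow A. x * (card S * ?g S) + x * ?g S)"
    unfolding sum_Pow_insert[OF insert.hyps]
    by (intro arg_cong2[where f = "(+)"] sum.cong)
      (simp_all add: card_insert_Diff_subset[OF insert.hyps] algebra_simps)
  also have "\<dots> = (x + y) * (card A * x * (x + y) ^ (card A - 1)) + x * (x + y) ^ card A"
    using insert.IH sum_Pow_binomial[OF insert.hyps(1), of x y]
    by (simp add: sum.distrib algebra_simps flip: sum_distrib_left)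
  \<comment> \<open>For \<open>card A = 0\<close> the exponent \<open>card A - 1\<close> is
    truncated, but the factor \<open>card A\<close> removes that term.\<close>
  also have "\<dots> = Suc (card A) * x * (x + y) ^ card A"
    by (cases "card A") (simp_all add: algebra_simps)
  finally show ?case
    using insert.hyps by simp
qed simp

section \<open>The closed formula for the number of acyclic maps\<close>

lemma card_acyclic_maps:
  fixes A B C :: "'a set"
  assumes "finite A" "finite B" "finite C"
    and "A \<inter> B = {}" "A \<inter> C = {}" "B \<inter> C = {}" and "A \<noteq> {}"
  shows "card (acyclic_maps A B C) =
    card C * card A ^ card B * (card B + card C) ^ (card A - 1)"
  using assms
proof (induction "card A + card B" arbitrary: A B C rule: less_induct)
  case less
  show ?case
  proof (cases "B = {}")
    case True
    have "h \<in> acyclic_maps A {} C" if h: "h \<in> A \<rightarrow>\<^sub>E C" for h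
    proof -
      \<comment> \<open>With \<open>B\<close> empty every map from \<open>A\<close> to
        \<open>C\<close> is acyclic: rank 1 on \<open>A\<close> and 0 elsewhere serves them
        all.\<close>
      have "\<forall>x \<in> A. (if h x \<in> A then 1 else 0 :: nat) < (if x \<in> A then 1 else 0)"
        using h less.prems(5) by auto
      then have "\<exists>rank :: 'a \<Rightarrow> nat. \<forall>x \<in> A. rank (h x) < rank x"
        by (rule exI[where x = "\<lambda>x. if x \<in> A then 1 else 0"])
      then show ?thesis
        using h by (auto simp: acyclic_maps_def)
    qed
    moreover have "h \<in> A \<rightarrow>\<^sub>E C" if "h \<in> acyclic_maps A {} C" for h
      using that by (simp add: acyclic_maps_def PiE_iff)
    ultimately have "acyclic_maps A {} C = A \<rightarrow>\<^sub>E C"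
      by blast
    then show ?thesis
      using less.prems True by (simp add: card_PiE card_gt_0_iff flip: power_Suc)
  next
    case False
    let ?n = "card A" and ?b = "card B" and ?k = "card C"
    have pos: "?n > 0" "?b > 0"
      using less.prems False by (simp_all add: card_gt_0_iff)
    \<comment> \<open>The induction hypothesis has the base \<open>card (A - S) + card S\<close>,
      which is \<open>card A\<close> for every \<open>S\<close>; the last factor therefore comes out
      of the sum. For empty \<open>S\<close> both sides vanish, and for other \<open>S\<close> the
      total size of the two sides drops.\<close>
    have IH: "card (acyclic_maps B (A - S) S) = card S * ?b ^ card (A - S) * ?n ^ (?b - 1)"
      if S: "S \<subseteq> A" for S
    proof (cases "S = {}")
      case True
      then show ?thesis using acyclic_maps_no_sinks[OF False] by simp
    next
      case nonempty: False
      have finS: "finite S"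
        using S less.prems(1) finite_subset by blast
      have n: "card (A - S) + card S = ?n"
        using S finS less.prems(1) by (simp add: card_Diff_subset card_mono)
      moreover have "card S > 0"
        using nonempty finS by (simp add: card_gt_0_iff)
      ultimately have "card B + card (A - S) < card A + card B"
        by linarith
      then show ?thesis
        using less.hyps[of B "A - S" S] less.prems S finS False n by auto
    qed
    have "card (acyclic_maps A B C) =
      (\<Sum>S \<in> Pow A. ?k ^ card S * (card S * ?b ^ card (A - S) * ?n ^ (?b - 1)))"
      using card_acyclic_maps_rec[of A B C] less.prems IH by simp
    also have "\<dots> = ?n ^ (?b - 1) * (\<Sum>S \<in> Pow A. card S * (?k ^ card S * ?b ^ card (A - S)))"
      unfolding sum_distrib_left by (intro sum.cong) (simp_all add: ac_simps)
    also have "\<dots> = ?n ^ (?b - 1) * (?n * ?k * (?k + ?b) ^ (?n - 1))"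
      using sum_Pow_card_binomial[OF less.prems(1)] by simp
    also have "\<dots> = ?k * ?n ^ ?b * (?b + ?k) ^ (?n - 1)"
      using pos by (cases ?b) (simp_all add: ac_simps)
    finally show ?thesis .
  qed
qed

section \<open>Translation of the graph into acyclic maps\<close>

text \<open>The \<open>k\<close> parallel edges from \<open>P i\<close> to the root \<open>Q m\<close> are encoded as edges to the \<open>k\<close>
  distinct sinks \<open>Q m, \<dots>, Q (m + k - 1)\<close>.\<close>

lemma card_parent_maps_modified_complete_bipartite:
  assumes "m \<ge> 1" "k \<ge> 1"
  shows "card (parent_maps (modified_complete_bipartite k m n) (Q m)) =
    card (acyclic_maps (P ` {1..n}) (Q ` {1..<m}) (Q ` {m..<m + k}))"
proof -
  let ?G = "modified_complete_bipartite k m n"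
  define A B C where "A = P ` {1..n}" and "B = Q ` {1..<m}" and "C = Q ` {m..<m + k}"
  \<comment> \<open>Copies are numbered from 1, so the sink \<open>Q j\<close> with
    \<open>j \<ge> m\<close> stands for copy \<open>Suc j - m\<close> of the edge to the
    root.\<close>
  define edge where "edge x y = (case (x, y) of
      (P i, Q j) \<Rightarrow> if j < m then ((j, i), 1) else ((m, i), Suc j - m)
    | (Q j, P i) \<Rightarrow> ((j, i), 1))" for x y
  \<comment> \<open>The inverse reading: copy \<open>c\<close> of an edge from \<open>P i\<close> to
    the root leads to the sink \<open>Q (m + c - 1)\<close>.\<close>
  define target where "target x e = (case x of
      P i \<Rightarrow> (case e of ((j, _), c) \<Rightarrow> if j < m then Q j else Q (m + c - 1))
    | Q j \<Rightarrow> (case e of ((_, i), c) \<Rightarrow> P i))" for x and e :: "(nat \<times> nat) \<times> nat"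
  have verts: "mverts ?G = A \<union> B \<union> {Q m}" "mverts ?G - {Q m} = A \<union> B"
    using assms by (auto simp: modified_complete_bipartite_def multiply_edges_def
        complete_bipartite_def A_def B_def image_iff)
  have ends: "mends ?G ((j, i), c) = {Q j, P i}" for j i c
    by (simp add: modified_complete_bipartite_def multiply_edges_def complete_bipartite_def)
  note edges = medges_modified_complete_bipartite[of k m n]
  \<comment> \<open>All sinks are merged into the single root \<open>Q m\<close>, which is itself
    one of them.\<close>
  define collapse where "collapse y = (if y \<in> C then Q m else y)" for y
  have edge: "edge x y \<in> medges ?G \<and> mends ?G (edge x y) = {x, collapse y} \<and>
      collapse y \<in> mverts ?G \<and> target x (edge x y) = y"
    if "x \<in> A \<union> B" "y \<in> (if x \<in> A then B \<union> C else A)" for x y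
    using that assms unfolding verts
    by (auto simp: A_def B_def C_def edge_def target_def collapse_def edges ends
        image_iff insert_commute split: if_splits)
  have mem: "P i \<in> P ` I \<longleftrightarrow> i \<in> I" "Q i \<in> Q ` I \<longleftrightarrow> i \<in> I" for i I
    by auto
  have target: "target x e \<in> (if x \<in> A then B \<union> C else A) \<and> edge x (target x e) = e"
    if "x \<in> A \<union> B" "e \<in> medges ?G" "x \<in> mends ?G e" for x e
    using that assms
    by (cases e) (auto simp: A_def B_def C_def edge_def target_def edges ends
        mem split: if_splits)
  have "bij_betw (\<lambda>h. restrict (\<lambda>x. edge x (h x)) (A \<union> B)) (acyclic_maps A B C)
    (parent_maps ?G (Q m))"
  proof (rule bij_betwI[where g = "\<lambda>p. restrict (\<lambda>x. target x (p x)) (A \<union> B)"])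
    show "(\<lambda>h. restrict (\<lambda>x. edge x (h x)) (A \<union> B)) \<in>
      acyclic_maps A B C \<rightarrow> parent_maps ?G (Q m)"
    proof (rule funcsetI)
      fix h assume "h \<in> acyclic_maps A B C"
      then obtain rank :: "bip_vertex \<Rightarrow> nat" where
        h: "\<And>x. x \<in> A \<union> B \<Longrightarrow> h x \<in> (if x \<in> A then B \<union> C else A)"
        and rank: "\<And>x. x \<in> A \<union> B \<Longrightarrow> rank (h x) < rank x"
        by (auto simp: acyclic_maps_def PiE_iff)
      \<comment> \<open>The sinks may have different ranks, but the root needs one; 0 lies below all
        the shifted ranks.\<close>
      let ?rank = "\<lambda>y. if y = Q m then 0 else Suc (rank y)"
      have "\<exists>u \<in> mverts ?G. mends ?G (edge x (h x)) = {x, u} \<and> ?rank u < ?rank x"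
        if "x \<in> A \<union> B" for x
      proof (intro bexI conjI)
        have "x \<noteq> Q m" using that by (auto simp: A_def B_def)
        then show "?rank (collapse (h x)) < ?rank x"
          using rank[OF that] by (auto simp: collapse_def)
      qed (use edge[OF that h[OF that]] in auto)
      then show "restrict (\<lambda>x. edge x (h x)) (A \<union> B) \<in> parent_maps ?G (Q m)"
        using edge[OF _ h] unfolding parent_maps_def verts(2)
        by (intro CollectI conjI exI[of _ ?rank]) (simp_all add: PiE_iff)
    qed
  next
    show "(\<lambda>p. restrict (\<lambda>x. target x (p x)) (A \<union> B)) \<in>
      parent_maps ?G (Q m) \<rightarrow> acyclic_maps A B C"
    proof (rule funcsetI)
      fix p assume "p \<in> parent_maps ?G (Q m)"
      then obtain rank :: "bip_vertex \<Rightarrow> nat" where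
        p: "\<And>x. x \<in> A \<union> B \<Longrightarrow> p x \<in> medges ?G"
        and rank: "\<And>x. x \<in> A \<union> B \<Longrightarrow> \<exists>u \<in> mverts ?G. mends ?G (p x) = {x, u} \<and> rank u < rank x"
        unfolding parent_maps_def verts(2) by (auto simp: PiE_iff)
      have tgt: "target x (p x) \<in> (if x \<in> A then B \<union> C else A)" "edge x (target x (p x)) = p x"
        if "x \<in> A \<union> B" for x
        using target[OF that p[OF that]] rank[OF that] by auto
      \<comment> \<open>Conversely, every sink receives the rank of the root.\<close>
      have "rank (collapse (target x (p x))) < rank (collapse x)" if x: "x \<in> A \<union> B" for x
      proof -
        have "mends ?G (p x) = {x, collapse (target x (p x))}"
          using edge[OF x tgt(1)[OF x]] tgt(2)[OF x] by simp
        moreover have "collapse x = x"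
          using x by (auto simp: collapse_def A_def B_def C_def)
        ultimately show ?thesis
          using rank[OF x] by (auto simp: doubleton_eq_iff)
      qed
      then show "restrict (\<lambda>x. target x (p x)) (A \<union> B) \<in> acyclic_maps A B C"
        unfolding acyclic_maps_def using tgt(1)
        by (intro CollectI conjI exI[of _ "\<lambda>x. rank (collapse x)"]) auto
    qed
  next
    fix h assume "h \<in> acyclic_maps A B C"
    then have "h \<in> extensional (A \<union> B)"
      and "\<And>x. x \<in> A \<union> B \<Longrightarrow> target x (edge x (h x)) = h x"
      using edge by (auto simp: acyclic_maps_def PiE_iff)
    then show "restrict (\<lambda>x. target x (restrict (\<lambda>x. edge x (h x)) (A \<union> B) x)) (A \<union> B) = h"
      by (intro extensionalityI[of _ "A \<union> B"]) auto
  next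
    fix p assume "p \<in> parent_maps ?G (Q m)"
    then have "p \<in> extensional (A \<union> B)"
      and "\<And>x. x \<in> A \<union> B \<Longrightarrow> edge x (target x (p x)) = p x"
    proof -
      fix x assume x: "x \<in> A \<union> B"
      then have "p x \<in> medges ?G" "x \<in> mends ?G (p x)"
        using \<open>p \<in> parent_maps ?G (Q m)\<close> unfolding parent_maps_def verts(2)
        by (auto simp: PiE_iff)
      then show "edge x (target x (p x)) = p x"
        using target[OF x] by blast
    qed (simp add: parent_maps_def verts(2) PiE_iff)
    then show "restrict (\<lambda>x. edge x (restrict (\<lambda>x. target x (p x)) (A \<union> B) x)) (A \<union> B) = p"
      by (intro extensionalityI[of _ "A \<union> B"]) auto
  qed
  then show ?thesis
    by (simp add: bij_betw_same_card A_def B_def C_def)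
qed

theorem theorem3p1:
  fixes m n k :: nat
  assumes "m \<ge> 1" and "n \<ge> 1" and "k \<ge> 1"
  shows "num_spanning_trees (modified_complete_bipartite k m n)
           = k * n ^ (m - 1) * (m + k - 1) ^ (n - 1)"
proof -
  let ?G = "modified_complete_bipartite k m n"
  have "mverts ?G = P ` {1..n} \<union> Q ` {1..m}"
    by (simp add: modified_complete_bipartite_def multiply_edges_def complete_bipartite_def)
  then have "num_spanning_trees ?G = card (parent_maps ?G (Q m))"
    using assms by (intro num_spanning_trees_eq_card_parent_maps wf_modified_complete_bipartite) auto
  also have "\<dots> = card (acyclic_maps (P ` {1..n}) (Q ` {1..<m}) (Q ` {m..<m + k}))"
    using assms by (intro card_parent_maps_modified_complete_bipartite)
  \<comment> \<open>The second base is \<open>(m - 1) + k\<close>, which equals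
    \<open>m + k - 1\<close> because \<open>m \<ge> 1\<close>; \<open>n \<ge> 1\<close> makes the
    first side nonempty.\<close>
  also have "\<dots> = k * n ^ (m - 1) * (m + k - 1) ^ (n - 1)"
    using assms by (subst card_acyclic_maps) (auto simp: card_image inj_on_def)
  finally show ?thesis .
qed

end
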